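(* Let $r$ be a given (rational) line and let $\Omega$ be a minor line with respect to $r$. If $\gamma$ is the line with $\Omega^2=\gamma r$, then $\gamma$ is a fourth apotome with respect to $r$.
   Context: Lines (straight-line segments) are represented by positive real numbers, and areas of rectangles by products. Two lines (or two areas) are commensurable if their quotient is a rational number, and incommensurable otherwise. Two lines are incommensurable in square if their squares are incommensurable. Fix a line $r$. A line $a$ is rational (with respect to $r$) if $a^2,r^2$ are commensurable; an area is rational if it is commensurable with $r^2$. A line $m$ is medial if there are rational lines $a,b$, incommensurable with each other, such that $m^2=ab$; an area is medial if it equals $m^2$ for some medial line $m$. A line $\Omega$ is a minor line (with respect to $r$) if there are lines $\Phi>\Psi$ with $\Omega=\Phi-\Psi$ such that $\Phi,\Psi$ are incommensurable in square, $\Phi^2+\Psi^2$ is a rational area, and $\Phi\Psi$ (equivalently $2\Phi\Psi$) is a medial area. A line $\gamma$ is an apotome with respect to $r$ if $\gamma=\zeta-\eta$ for lines $\zeta>\eta$ such that $\zeta,\eta$ are incommensurable and $\zeta^2,\eta^2,r^2$ are commensurable. It is a fourth apotome with respect to $r$ if moreover $\zeta$ is commensurable with $r$ and the line $\theta$ with $\theta^2=\zeta^2-\eta^2$ is incommensurable with $\zeta$. *)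

theory Defs
  imports Complex_Main
begin

text \<open>
  Lines and areas are represented by positive reals. Positivity of each line is imposed in the
  definitions below or in the hypotheses of the theorem; \<open>commensurable\<close> is only meaningful for
  positive arguments (division by zero would make it hold vacuously). It serves for both lines
  and areas. The fixed line \<open>r\<close> is an explicit first argument.
\<close>

definition commensurable :: "real \<Rightarrow> real \<Rightarrow> bool" where
  "commensurable x y \<longleftrightarrow> x / y \<in> \<rat>"

abbreviation incommensurable :: "real \<Rightarrow> real \<Rightarrow> bool" where
  "incommensurable x y \<equiv> \<not> commensurable x y"

definition incommensurable_in_square :: "real \<Rightarrow> real \<Rightarrow> bool" where
  "incommensurable_in_square a b \<longleftrightarrow> incommensurable (a\<^sup>2) (b\<^sup>2)"

text \<open>
  Rationality is Euclid's: a rational line is one whose square is commensurable with that of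
  \<open>r\<close>, so its ratio to \<open>r\<close> need not be a rational number.
\<close>

definition rational_line :: "real \<Rightarrow> real \<Rightarrow> bool" where
  "rational_line r a \<longleftrightarrow> 0 < a \<and> commensurable (a\<^sup>2) (r\<^sup>2)"

definition rational_area :: "real \<Rightarrow> real \<Rightarrow> bool" where
  "rational_area r A \<longleftrightarrow> 0 < A \<and> commensurable A (r\<^sup>2)"

definition medial_line :: "real \<Rightarrow> real \<Rightarrow> bool" where
  "medial_line r m \<longleftrightarrow> 0 < m \<and>
     (\<exists>a b. rational_line r a \<and> rational_line r b \<and> incommensurable a b \<and> m\<^sup>2 = a * b)"

definition medial_area :: "real \<Rightarrow> real \<Rightarrow> bool" where
  "medial_area r A \<longleftrightarrow> (\<exists>m. medial_line r m \<and> A = m\<^sup>2)"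

definition minor_line :: "real \<Rightarrow> real \<Rightarrow> bool" where
  "minor_line r \<Omega> \<longleftrightarrow>
     (\<exists>\<Phi> \<Psi>. 0 < \<Psi> \<and> \<Psi> < \<Phi> \<and> \<Omega> = \<Phi> - \<Psi> \<and>
        incommensurable_in_square \<Phi> \<Psi> \<and>
        rational_area r (\<Phi>\<^sup>2 + \<Psi>\<^sup>2) \<and>
        medial_area r (\<Phi> * \<Psi>))"

text \<open>
  The decomposition \<open>\<gamma> = \<zeta> - \<eta>\<close> is kept as a separate predicate because the extra conditions on a
  fourth apotome concern the same \<open>\<zeta>\<close> and \<open>\<eta>\<close> that witness that \<open>\<gamma>\<close> is an apotome.
\<close>

definition apotome_decomposition :: "real \<Rightarrow> real \<Rightarrow> real \<Rightarrow> real \<Rightarrow> bool" where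
  "apotome_decomposition r \<gamma> \<zeta> \<eta> \<longleftrightarrow>
     0 < \<eta> \<and> \<eta> < \<zeta> \<and> \<gamma> = \<zeta> - \<eta> \<and> incommensurable \<zeta> \<eta> \<and>
     commensurable (\<zeta>\<^sup>2) (\<eta>\<^sup>2) \<and> commensurable (\<eta>\<^sup>2) (r\<^sup>2) \<and> commensurable (\<zeta>\<^sup>2) (r\<^sup>2)"

definition apotome :: "real \<Rightarrow> real \<Rightarrow> bool" where
  "apotome r \<gamma> \<longleftrightarrow> (\<exists>\<zeta> \<eta>. apotome_decomposition r \<gamma> \<zeta> \<eta>)"

definition fourth_apotome :: "real \<Rightarrow> real \<Rightarrow> bool" where
  "fourth_apotome r \<gamma> \<longleftrightarrow>
     (\<exists>\<zeta> \<eta>. apotome_decomposition r \<gamma> \<zeta> \<eta> \<and> commensurable \<zeta> r \<and>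
        (\<exists>\<theta>. 0 < \<theta> \<and> \<theta>\<^sup>2 = \<zeta>\<^sup>2 - \<eta>\<^sup>2 \<and> incommensurable \<theta> \<zeta>))"

end

theory Submission
  imports Defs
begin

text \<open>
  Expanding \<open>\<Omega>\<^sup>2 = (\<Phi> - \<Psi>)\<^sup>2 = (\<Phi>\<^sup>2 + \<Psi>\<^sup>2) - 2\<Phi>\<Psi>\<close> and dividing by \<open>r\<close> exhibits \<open>\<gamma>\<close> as
  \<open>\<zeta> - \<eta>\<close>, where \<open>\<zeta> = (\<Phi>\<^sup>2 + \<Psi>\<^sup>2) / r\<close> and \<open>\<eta> = 2\<Phi>\<Psi> / r\<close>. Applying a rational area to \<open>r\<close>
  gives a breadth commensurable with \<open>r\<close>, and applying a medial area gives a breadth commensurable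
  with \<open>r\<close> in square only (\<open>medial_area_apply\<close>). Hence \<open>\<zeta>\<close> and \<open>\<eta>\<close> form an apotome with \<open>\<zeta>\<close>
  commensurable with \<open>r\<close>. It is a fourth apotome because
  \<open>(\<Phi>\<^sup>2 + \<Psi>\<^sup>2)\<^sup>2 - (2\<Phi>\<Psi>)\<^sup>2 = (\<Phi>\<^sup>2 - \<Psi>\<^sup>2)\<^sup>2\<close>, so that \<open>\<theta> = (\<Phi>\<^sup>2 - \<Psi>\<^sup>2) / r\<close>, and the difference and the
  sum of \<open>\<Phi>\<^sup>2\<close> and \<open>\<Psi>\<^sup>2\<close> are incommensurable because \<open>\<Phi>\<^sup>2\<close> and \<open>\<Psi>\<^sup>2\<close> are
  (\<open>commensurable_of_diff_sum\<close>).
\<close>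

lemma commensurable_sym: "commensurable x y \<Longrightarrow> commensurable y x"
  unfolding commensurable_def using Rats_inverse[of "x / y"] by simp

lemma commensurable_trans:
  assumes "commensurable x y" and "commensurable y z" and "y \<noteq> 0"
  shows "commensurable x z"
  using Rats_mult[OF assms(1,2)[unfolded commensurable_def]] assms(3)
  by (simp add: commensurable_def)

lemma commensurable_power2: "commensurable x y \<Longrightarrow> commensurable (x\<^sup>2) (y\<^sup>2)"
  unfolding commensurable_def power_divide[symmetric] by (rule Rats_power)

text \<open>
  If \<open>q\<close> is the ratio of \<open>x - y\<close> to \<open>x + y\<close>, then \<open>x / y\<close> is \<open>(1 + q) / (1 - q)\<close>.
\<close>

lemma commensurable_of_diff_sum:
  assumes "commensurable (x - y) (x + y)" and "x + y \<noteq> 0"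
  shows "commensurable x y"
proof -
  define q where "q = (x - y) / (x + y)"
  have q: "q \<in> \<rat>" using assms(1) by (simp add: commensurable_def q_def)
  have "1 + q = 2 * x / (x + y)" and "1 - q = 2 * y / (x + y)"
    using assms(2) by (simp_all add: q_def field_simps)
  then have "x / y = (1 + q) / (1 - q)" using assms(2) by simp
  also have "\<dots> \<in> \<rat>" using q by simp
  finally show ?thesis by (simp add: commensurable_def)
qed

text \<open>
  Write the area as \<open>a b\<close> with \<open>a\<close> and \<open>b\<close> rational and incommensurable. The square of the ratio
  \<open>a b / r\<^sup>2\<close> is the product of the rational numbers \<open>a\<^sup>2 / r\<^sup>2\<close> and \<open>b\<^sup>2 / r\<^sup>2\<close>, whereas
  the ratio itself differs from \<open>a / b\<close> only by the rational factor \<open>b\<^sup>2 / r\<^sup>2\<close>.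
\<close>

lemma medial_area_apply:
  assumes "r \<noteq> 0" and "medial_area r A"
  shows "commensurable ((A / r)\<^sup>2) (r\<^sup>2)" and "incommensurable (A / r) r"
proof -
  obtain a b where a: "0 < a" "a\<^sup>2 / r\<^sup>2 \<in> \<rat>" and b: "0 < b" "b\<^sup>2 / r\<^sup>2 \<in> \<rat>"
    and ab: "a / b \<notin> \<rat>" and A: "A = a * b"
    using assms(2)
    by (auto simp: medial_area_def medial_line_def rational_line_def commensurable_def)
  have "(A / r)\<^sup>2 / r\<^sup>2 = (a\<^sup>2 / r\<^sup>2) * (b\<^sup>2 / r\<^sup>2)"
    by (simp add: A power_divide power_mult_distrib)
  then show "commensurable ((A / r)\<^sup>2) (r\<^sup>2)"
    using Rats_mult[OF a(2) b(2)] by (simp add: commensurable_def)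
  have "a / b = (A / r / r) / (b\<^sup>2 / r\<^sup>2)"
    using assms(1) b(1) by (simp add: A field_simps power2_eq_square)
  then show "incommensurable (A / r) r"
    using ab Rats_divide[OF _ b(2), of "A / r / r"] by (auto simp only: commensurable_def)
qed

theorem propositionX100:
  fixes r \<Omega> \<gamma> :: real
  assumes "0 < r"
    and "minor_line r \<Omega>"
    and "0 < \<gamma>"
    and "\<Omega>\<^sup>2 = \<gamma> * r"
  shows "fourth_apotome r \<gamma>"
proof -
  obtain \<Phi> \<Psi> where pos: "0 < \<Psi>" "\<Psi> < \<Phi>" and \<Omega>: "\<Omega> = \<Phi> - \<Psi>"
    and inc: "incommensurable (\<Phi>\<^sup>2) (\<Psi>\<^sup>2)"
    and rat: "commensurable (\<Phi>\<^sup>2 + \<Psi>\<^sup>2) (r\<^sup>2)"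
    and med: "medial_area r (\<Phi> * \<Psi>)"
    using assms(2)
    by (auto simp: minor_line_def incommensurable_in_square_def rational_area_def)
  define \<zeta> \<eta> \<theta> where "\<zeta> = (\<Phi>\<^sup>2 + \<Psi>\<^sup>2) / r" and "\<eta> = 2 * (\<Phi> * \<Psi> / r)"
    and "\<theta> = (\<Phi>\<^sup>2 - \<Psi>\<^sup>2) / r"
  note defs = \<zeta>_def \<eta>_def \<theta>_def
  have \<gamma>: "\<gamma> = \<zeta> - \<eta>"
    using assms(1,4) by (simp add: \<Omega> defs field_simps power2_eq_square)
  have \<eta>_pos: "0 < \<eta>" using pos assms(1) by (simp add: defs)
  have \<eta>_less: "\<eta> < \<zeta>" using \<gamma> assms(3) by simp
  have \<zeta>_pos: "0 < \<zeta>" using \<eta>_pos \<eta>_less by simp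
  have \<zeta>_r: "commensurable \<zeta> r"
    using rat by (simp add: commensurable_def defs power2_eq_square)
  have \<zeta>2: "commensurable (\<zeta>\<^sup>2) (r\<^sup>2)"
    using \<zeta>_r by (rule commensurable_power2)
  have "r \<noteq> 0" using assms(1) by simp
  note half_\<eta> = medial_area_apply[OF this med]
  have half_nz: "\<Phi> * \<Psi> / r \<noteq> 0" using \<eta>_pos by (auto simp: \<eta>_def)
  have \<eta>_half: "commensurable \<eta> (\<Phi> * \<Psi> / r)"
    using half_nz by (simp add: commensurable_def \<eta>_def)
  have \<eta>_r: "incommensurable \<eta> r"
  proof
    assume "commensurable \<eta> r"
    then have "commensurable (\<Phi> * \<Psi> / r) r"
      by (rule commensurable_trans[OF commensurable_sym[OF \<eta>_half]]) (use \<eta>_pos in simp)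
    with half_\<eta>(2) show False ..
  qed
  have \<eta>2: "commensurable (\<eta>\<^sup>2) (r\<^sup>2)"
    by (rule commensurable_trans[OF commensurable_power2[OF \<eta>_half] half_\<eta>(1)])
      (use half_nz in simp)
  have "incommensurable \<zeta> \<eta>"
  proof
    assume "commensurable \<zeta> \<eta>"
    then have "commensurable \<eta> r"
      by (rule commensurable_trans[OF commensurable_sym \<zeta>_r]) (use \<zeta>_pos in simp)
    with \<eta>_r show False ..
  qed
  moreover have "commensurable (\<zeta>\<^sup>2) (\<eta>\<^sup>2)"
    using commensurable_trans[OF \<zeta>2 commensurable_sym[OF \<eta>2]] assms(1) by simp
  ultimately have "apotome_decomposition r \<gamma> \<zeta> \<eta>"
    unfolding apotome_decomposition_def using \<gamma> \<eta>_pos \<eta>_less \<zeta>2 \<eta>2 by simp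
  moreover have "0 < \<theta>"
    using pos assms(1) by (simp add: defs power_strict_mono)
  moreover have "\<theta>\<^sup>2 = \<zeta>\<^sup>2 - \<eta>\<^sup>2"
    using assms(1) by (simp add: defs field_simps power2_eq_square)
  moreover have "incommensurable \<theta> \<zeta>"
  proof
    assume "commensurable \<theta> \<zeta>"
    then have "commensurable (\<Phi>\<^sup>2 - \<Psi>\<^sup>2) (\<Phi>\<^sup>2 + \<Psi>\<^sup>2)"
      using assms(1) by (simp add: commensurable_def defs)
    then have "commensurable (\<Phi>\<^sup>2) (\<Psi>\<^sup>2)"
      by (rule commensurable_of_diff_sum) (use pos in simp)
    with inc show False ..
  qed
  ultimately show ?thesis
    unfolding fourth_apotome_def using \<zeta>_r by blast
qed

end
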